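(* Let $U\subset\mathbb{R}$ be open, let $k\ge 2$, let $f:U\to\mathbb{R}$ be a $C^k$ function, and let $x\in U$ be a point at which $f$ is of transversal type. If $f'(x)f''(x)\neq 0$, then there exist $\varepsilon_0>0$ and a function $\Pi_x^f:(0,\varepsilon_0)\to\mathbb{R}^+$ such that: (i) $\Pi_x^f$ is a $C^{k-1}$ diffeomorphism onto its image; (ii) $\Pi_x^f$ is monotonically increasing; (iii) for every $\varepsilon\in(0,\varepsilon_0)$, if $\delta=\Pi_x^f(\varepsilon)$, $y\in U$ and $|x-y|<\delta$, then $|f(x)-f(y)|<\varepsilon$; (iv) for every $\varepsilon\in(0,\varepsilon_0)$, $\Pi_x^f(\varepsilon)$ is the maximum $\delta>0$ for which the implication in (iii) holds; (v) $\Pi_x^f$ is computable, provided that $f$ and $x$ are computable.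
   Context: $\mathbb{R}^+$ denotes the positive reals. A differentiable function $f:U\to\mathbb{R}$ on an open set $U\subset\mathbb{R}$ is of transversal type at $x\in U$ if the equation $f'(y)=\frac{f(y)-f(x)}{y-x}$ (in the unknown $y\in U$, $y\ne x$) has only finitely many solutions. Computability of a real number or real function is understood in the usual sense: there is an algorithm that determines the value (for a function, given its argument) to within any prescribed precision. *)

theory Defs
  imports "HOL-Analysis.Analysis" "HOL-Library.Nat_Bijection"
begin

subsection \<open>Differentiability classes\<close>

text \<open>These definitions are meant for open \<open>S\<close>, where \<open>deriv\<close> only depends on the values of
  the function on \<open>S\<close>.\<close>

definition Ck_on :: "nat \<Rightarrow> real set \<Rightarrow> (real \<Rightarrow> real) \<Rightarrow> bool" where
  "Ck_on k S f \<longleftrightarrow>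
     (\<forall>j<k. (deriv ^^ j) f differentiable_on S) \<and> continuous_on S ((deriv ^^ k) f)"

definition Ck_diffeo_onto_image :: "nat \<Rightarrow> real set \<Rightarrow> (real \<Rightarrow> real) \<Rightarrow> bool" where
  "Ck_diffeo_onto_image k S g \<longleftrightarrow>
     open S \<and> open (g ` S) \<and> inj_on g S \<and> Ck_on k S g \<and> Ck_on k (g ` S) (inv_into S g)"

definition transversal_type :: "real set \<Rightarrow> (real \<Rightarrow> real) \<Rightarrow> real \<Rightarrow> bool" where
  "transversal_type U f x \<longleftrightarrow>
     open U \<and> f differentiable_on U \<and> x \<in> U \<and>
     finite {y \<in> U. y \<noteq> x \<and> deriv f y = (f y - f x) / (y - x)}"

subsection \<open>Computability\<close>

text \<open>Algorithms are the partial recursive functionals: the usual schemes for partial recursive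
  functions on the natural numbers, extended by \<open>Query\<close>, which asks for a value of an external
  function \<open>\<phi>\<close>. The relation \<open>eval \<phi> p xs z\<close> says that \<open>p\<close>, with access to \<open>\<phi>\<close> and applied to the
  argument list \<open>xs\<close>, halts with result \<open>z\<close>.\<close>

datatype prog =
    Zero
  | Succ
  | Proj nat
  | Query
  | Comp prog "prog list"
  | PrimRec prog prog
  | Mu prog

inductive eval :: "(nat \<Rightarrow> nat) \<Rightarrow> prog \<Rightarrow> nat list \<Rightarrow> nat \<Rightarrow> bool" for \<phi> where
  eval_Zero: "eval \<phi> Zero xs 0"
| eval_Succ: "eval \<phi> Succ (n # xs) (Suc n)"
| eval_Proj: "i < length xs \<Longrightarrow> eval \<phi> (Proj i) xs (xs ! i)"
| eval_Query: "eval \<phi> Query (n # xs) (\<phi> n)"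
| eval_Comp: "list_all2 (\<lambda>g y. eval \<phi> g xs y) gs ys \<Longrightarrow> eval \<phi> h ys z \<Longrightarrow>
    eval \<phi> (Comp h gs) xs z"
| eval_PrimRec_0: "eval \<phi> g xs z \<Longrightarrow> eval \<phi> (PrimRec g h) (0 # xs) z"
| eval_PrimRec_Suc: "eval \<phi> (PrimRec g h) (n # xs) y \<Longrightarrow> eval \<phi> h (n # y # xs) z \<Longrightarrow>
    eval \<phi> (PrimRec g h) (Suc n # xs) z"
| eval_Mu: "eval \<phi> g (n # xs) 0 \<Longrightarrow> (\<And>i. i < n \<Longrightarrow> \<exists>y. eval \<phi> g (i # xs) (Suc y)) \<Longrightarrow>
    eval \<phi> (Mu g) xs n"

inductive_cases eval_ZeroE: "eval \<phi> Zero xs z"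
inductive_cases eval_SuccE: "eval \<phi> Succ (n # xs) z"
inductive_cases eval_ProjE: "eval \<phi> (Proj i) xs z"
inductive_cases eval_QueryE: "eval \<phi> Query (n # xs) z"
inductive_cases eval_CompE: "eval \<phi> (Comp h gs) xs z"
inductive_cases eval_PrimRec_0E: "eval \<phi> (PrimRec g h) (0 # xs) z"
inductive_cases eval_PrimRec_SucE: "eval \<phi> (PrimRec g h) (Suc n # xs) z"
inductive_cases eval_MuE: "eval \<phi> (Mu g) xs z"

lemma eval_deterministic:
  assumes "eval \<phi> p xs y" "eval \<phi> p xs z"
  shows "y = z"
  using assms
proof (induction arbitrary: z rule: eval.induct)
  case (eval_Zero xs)
  then show ?case by (rule eval_ZeroE) simp
next
  case (eval_Succ n xs)
  then show ?case by (rule eval_SuccE) simp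
next
  case (eval_Proj i xs)
  from eval_Proj(2) show ?case by (rule eval_ProjE) simp
next
  case (eval_Query n xs)
  then show ?case by (rule eval_QueryE) simp
next
  case (eval_Comp xs gs ys h y)
  from eval_Comp.prems obtain ys' where
    ys': "list_all2 (\<lambda>g y. eval \<phi> g xs y) gs ys'" "eval \<phi> h ys' z"
    by (rule eval_CompE)
  have "ys = ys'"
  proof (rule nth_equalityI)
    show "length ys = length ys'"
      using list_all2_lengthD[OF eval_Comp.IH(1)] list_all2_lengthD[OF ys'(1)] by simp
    fix i assume "i < length ys"
    then show "ys ! i = ys' ! i"
      using list_all2_nthD2[OF eval_Comp.IH(1), of i] list_all2_nthD2[OF ys'(1), of i]
        \<open>length ys = length ys'\<close> by metis
  qed
  then show ?case
    using eval_Comp.IH(2) ys'(2) by blast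
next
  case (eval_PrimRec_0 g xs y h)
  from eval_PrimRec_0.prems have "eval \<phi> g xs z" by (rule eval_PrimRec_0E)
  then show ?case by (rule eval_PrimRec_0.IH)
next
  case (eval_PrimRec_Suc g h n xs y z')
  from eval_PrimRec_Suc.prems obtain y' where
    y': "eval \<phi> (PrimRec g h) (n # xs) y'" "eval \<phi> h (n # y' # xs) z"
    by (rule eval_PrimRec_SucE)
  have "y = y'" by (rule eval_PrimRec_Suc.IH(1)[OF y'(1)])
  with y'(2) show ?case by (simp add: eval_PrimRec_Suc.IH(2))
next
  case (eval_Mu g n xs)
  from eval_Mu.prems have
    z: "eval \<phi> g (z # xs) 0" "\<And>i. i < z \<Longrightarrow> \<exists>y. eval \<phi> g (i # xs) (Suc y)"
    by (rule eval_MuE; blast)+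
  show ?case
  proof (cases n z rule: linorder_cases)
    case less
    then obtain y where "eval \<phi> g (n # xs) (Suc y)" using z(2) by blast
    then show ?thesis using eval_Mu.IH(1) by blast
  next
    case greater
    then show ?thesis using eval_Mu.IH(2) z(1) by blast
  qed
qed

text \<open>\<open>\<phi>\<close> encodes \<open>x\<close> if its value at \<open>n\<close> is the code of an integer numerator
  approximating \<open>x\<close> with denominator and precision \<open>2 ^ n\<close>.\<close>

definition encodes_real :: "(nat \<Rightarrow> nat) \<Rightarrow> real \<Rightarrow> bool" where
  "encodes_real \<phi> x \<longleftrightarrow> (\<forall>n. \<bar>real_of_int (int_decode (\<phi> n)) / 2 ^ n - x\<bar> \<le> 1 / 2 ^ n)"

text \<open>Here \<open>Query\<close> is given the zero function, so that it yields nothing beyond ordinary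
  computability.\<close>

definition computable_real :: "real \<Rightarrow> bool" where
  "computable_real x \<longleftrightarrow>
     (\<exists>p \<psi>. encodes_real \<psi> x \<and> (\<forall>n. eval (\<lambda>_. 0) p [n] (\<psi> n)))"

text \<open>One algorithm has to work for all arguments \<open>y \<in> S\<close>, computable or not, and for all ways
  \<open>\<phi>\<close> of supplying approximations to \<open>y\<close>. Nothing is required outside of \<open>S\<close>.\<close>

definition computable_real_fun_on :: "real set \<Rightarrow> (real \<Rightarrow> real) \<Rightarrow> bool" where
  "computable_real_fun_on S f \<longleftrightarrow>
     (\<exists>p. \<forall>y\<in>S. \<forall>\<phi>. encodes_real \<phi> y \<longrightarrow>
        (\<exists>\<psi>. encodes_real \<psi> (f y) \<and> (\<forall>n. eval \<phi> p [n] (\<psi> n))))"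

end

theory Submission
  imports Defs
begin

text \<open>Let \<open>s\<close> be the sign of \<open>f'(x) f''(x)\<close>. Close to \<open>x\<close>, the function \<open>\<bar>f'\<bar>\<close> increases in the
  direction of \<open>s\<close>, so \<open>g h = \<bar>f (x + s h) - f x\<bar>\<close> dominates the increment on the opposite side, and
  the optimal \<open>\<delta>\<close> for \<open>\<epsilon>\<close> is the inverse of the strictly increasing function \<open>g\<close> at \<open>\<epsilon>\<close>. It is as smooth
  as \<open>f\<close> because \<open>g' > 0\<close>. To compute \<open>\<delta>\<close>, let \<open>i = 0, 1, 2, \<dots>\<close> until the available approximations of
  \<open>g (i / 2^N)\<close> and \<open>\<epsilon>\<close> agree up to a constant multiple of \<open>2^-N\<close>; lower and upper bounds of \<open>g'\<close> ensure
  that some \<open>i / 2^N \<le> \<delta>\<close> passes the test and that whatever passes first is close to \<open>\<delta>\<close>. Since the search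
  goes upwards, \<open>f\<close> is never queried outside of \<open>U\<close>.\<close>

subsection \<open>Calculus of differentiability classes\<close>

lemma Ck_on_0: "Ck_on 0 S f \<longleftrightarrow> continuous_on S f"
  by (simp add: Ck_on_def)

text \<open>Peeling off the innermost derivative of \<open>(deriv ^^ Suc j) f\<close> makes the
  class recursive in \<open>k\<close>, the form in which the inductions below use it.\<close>

lemma Ck_on_Suc: "Ck_on (Suc k) S f \<longleftrightarrow> f differentiable_on S \<and> Ck_on k S (deriv f)"
  unfolding Ck_on_def All_less_Suc2 funpow_Suc_right comp_def by simp

lemma Ck_on_Suc_imp: "Ck_on (Suc k) S f \<Longrightarrow> Ck_on k S f"
proof (induction k arbitrary: f)
  case 0
  then show ?case by (simp add: Ck_on_0 Ck_on_Suc differentiable_imp_continuous_on)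
next
  case (Suc k)
  from Suc.prems have "f differentiable_on S" "Ck_on (Suc k) S (deriv f)"
    unfolding Ck_on_Suc[of "Suc k"] by blast+
  with Suc.IH[of "deriv f"] show ?case by (simp only: Ck_on_Suc)
qed

lemma Ck_on_mono: "Ck_on k S f \<Longrightarrow> j \<le> k \<Longrightarrow> Ck_on j S f"
proof (induction k)
  case (Suc k)
  then show ?case using Ck_on_Suc_imp le_Suc_eq by blast
qed simp

lemma differentiable_on_real_iff:
  fixes f :: "real \<Rightarrow> real"
  assumes "open S"
  shows "f differentiable_on S \<longleftrightarrow> (\<forall>x\<in>S. (f has_real_derivative deriv f x) (at x))"
  using assms
  by (auto simp: differentiable_on_eq_differentiable_at real_differentiable_def
      DERIV_deriv_iff_real_differentiable)

lemma Ck_on_SucI: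
  assumes "open S" "\<And>x. x \<in> S \<Longrightarrow> (f has_real_derivative f' x) (at x)" "Ck_on k S (deriv f)"
  shows "Ck_on (Suc k) S f"
  using assms by (auto simp: Ck_on_Suc differentiable_on_eq_differentiable_at real_differentiable_def)

text \<open>Since \<open>S\<close> is open, functions that agree on it agree near each of its
  points, so their derivatives agree on \<open>S\<close> as well and the induction
  continues.\<close>

lemma Ck_on_cong:
  assumes "open S" "\<And>x. x \<in> S \<Longrightarrow> f x = g x" "Ck_on k S f"
  shows "Ck_on k S g"
  using assms(2,3)
proof (induction k arbitrary: f g)
  case 0
  then show ?case using continuous_on_cong[of S S f g] by (simp add: Ck_on_0)
next
  case (Suc k)
  have ev: "\<forall>\<^sub>F y in nhds x. f y = g y" if "x \<in> S" for x
    using assms(1) that Suc.prems(1) by (auto simp: eventually_nhds)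
  have f: "\<forall>x\<in>S. (f has_real_derivative deriv f x) (at x)" "Ck_on k S (deriv f)"
    using Suc.prems(2) assms(1) by (simp_all add: Ck_on_Suc differentiable_on_real_iff)
  show ?case
  proof (rule Ck_on_SucI[OF assms(1)])
    fix x assume "x \<in> S"
    with f(1) ev show "(g has_real_derivative deriv f x) (at x)"
      by (metis DERIV_cong_ev)
  next
    show "Ck_on k S (deriv g)"
      by (rule Suc.IH[OF _ f(2)]) (intro deriv_cong_ev ev refl)
  qed
qed

text \<open>With this rule the standard differentiation rules can be applied with an explicit
  \<open>f'\<close>, without evaluating \<open>deriv f\<close>.\<close>

lemma Ck_on_SucI':
  assumes "open S" "\<And>x. x \<in> S \<Longrightarrow> (f has_real_derivative f' x) (at x)" "Ck_on k S f'"
  shows "Ck_on (Suc k) S f"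
proof (rule Ck_on_SucI[OF assms(1,2)])
  show "Ck_on k S (deriv f)"
    by (rule Ck_on_cong[OF assms(1) _ assms(3)]) (rule DERIV_imp_deriv[OF assms(2), symmetric])
qed

lemma Ck_on_SucD:
  assumes "open S" "Ck_on (Suc k) S f"
  shows "x \<in> S \<Longrightarrow> (f has_real_derivative deriv f x) (at x)" "Ck_on k S (deriv f)" "Ck_on k S f"
  using assms Ck_on_Suc_imp by (simp_all add: Ck_on_Suc differentiable_on_real_iff)

lemma Ck_on_const: "Ck_on k S (\<lambda>_. c)"
  by (induction k arbitrary: c) (auto simp: Ck_on_0 Ck_on_Suc)

section \<open>Algebraic operations and composition\<close>

lemma Ck_on_add:
  assumes "open S" "Ck_on k S f" "Ck_on k S g"
  shows "Ck_on k S (\<lambda>x. f x + g x)"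
  using assms(2,3)
proof (induction k arbitrary: f g)
  case 0
  then show ?case by (simp add: Ck_on_0 continuous_on_add)
next
  case (Suc k)
  note f = Ck_on_SucD[OF assms(1) Suc.prems(1)] and g = Ck_on_SucD[OF assms(1) Suc.prems(2)]
  show ?case
    by (rule Ck_on_SucI'[OF assms(1) DERIV_add[OF f(1) g(1)] Suc.IH[OF f(2) g(2)]])
qed

lemma Ck_on_mult:
  assumes "open S" "Ck_on k S f" "Ck_on k S g"
  shows "Ck_on k S (\<lambda>x. f x * g x)"
  using assms(2,3)
proof (induction k arbitrary: f g)
  case 0
  then show ?case by (simp add: Ck_on_0 continuous_on_mult)
next
  case (Suc k)
  note f = Ck_on_SucD[OF assms(1) Suc.prems(1)] and g = Ck_on_SucD[OF assms(1) Suc.prems(2)]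
  show ?case
  proof (rule Ck_on_SucI'[OF assms(1), where f' = "\<lambda>x. deriv f x * g x + deriv g x * f x"])
    show "Ck_on k S (\<lambda>x. deriv f x * g x + deriv g x * f x)"
      by (intro Ck_on_add assms(1) Suc.IH f g)
    show "((\<lambda>x. f x * g x) has_real_derivative deriv f x * g x + deriv g x * f x) (at x)"
      if "x \<in> S" for x
      using DERIV_mult[OF f(1)[OF that] g(1)[OF that]] .
  qed
qed

text \<open>The derivative \<open>- f' / f^2\<close> is written with factors
  \<open>inverse (f x)\<close>, to which the induction hypothesis for the same \<open>f\<close>
  applies.\<close>

lemma Ck_on_inverse:
  assumes "open S" "Ck_on k S f" "\<And>x. x \<in> S \<Longrightarrow> f x \<noteq> 0"
  shows "Ck_on k S (\<lambda>x. inverse (f x))"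
  using assms(2,3)
proof (induction k)
  case 0
  then show ?case by (simp add: Ck_on_0 continuous_on_inverse)
next
  case (Suc k)
  note f = Ck_on_SucD[OF assms(1) Suc.prems(1)]
  show ?case
  proof (rule Ck_on_SucI'[OF assms(1),
        where f' = "\<lambda>x. (-1) * (inverse (f x) * deriv f x * inverse (f x))"])
    show "Ck_on k S (\<lambda>x. (-1) * (inverse (f x) * deriv f x * inverse (f x)))"
      by (intro Ck_on_mult Ck_on_const assms(1) Suc.IH f Suc.prems)
    fix x assume "x \<in> S"
    then show "((\<lambda>x. inverse (f x)) has_real_derivative
        (-1) * (inverse (f x) * deriv f x * inverse (f x))) (at x)"
      using DERIV_inverse'[OF f(1) Suc.prems(2)] by simp
  qed
qed

text \<open>By the chain rule the induction hypothesis is needed for \<open>deriv f\<close> with the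
  same \<open>g\<close>, so only \<open>f\<close> is generalized.\<close>

lemma Ck_on_compose:
  assumes "open S" "open T" "Ck_on k T f" "Ck_on k S g" "g ` S \<subseteq> T"
  shows "Ck_on k S (\<lambda>x. f (g x))"
  using assms(3,4)
proof (induction k arbitrary: f)
  case 0
  then show ?case using assms(5) by (simp add: Ck_on_0 continuous_on_compose2)
next
  case (Suc k)
  note f = Ck_on_SucD[OF assms(2) Suc.prems(1)] and g = Ck_on_SucD[OF assms(1) Suc.prems(2)]
  show ?case
  proof (rule Ck_on_SucI'[OF assms(1), where f' = "\<lambda>x. deriv f (g x) * deriv g x"])
    show "Ck_on k S (\<lambda>x. deriv f (g x) * deriv g x)"
      by (rule Ck_on_mult[OF assms(1) Suc.IH[OF f(2) g(3)] g(2)])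
    fix x assume "x \<in> S"
    then show "((\<lambda>x. f (g x)) has_real_derivative deriv f (g x) * deriv g x) (at x)"
      using assms(5) by (intro DERIV_chain2 f(1) g(1)) auto
  qed
qed

text \<open>Bootstrapping: \<open>P' = 1 / (g' o P)\<close>, so if \<open>P\<close> has class
  \<open>j < k\<close>, then so does the right-hand side, and \<open>P\<close> has class
  \<open>j + 1\<close>.\<close>

lemma Ck_on_inverse_function:
  assumes "open A" "open B" "Ck_on k A g" "k \<ge> 1"
    and "\<And>u. u \<in> A \<Longrightarrow> deriv g u \<noteq> 0"
    and "\<And>y. y \<in> B \<Longrightarrow> P y \<in> A" "\<And>y. y \<in> B \<Longrightarrow> g (P y) = y" "continuous_on B P"
  shows "Ck_on k B P"
proof -
  obtain k' where k': "k = Suc k'" using assms(4) by (cases k) auto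
  note g = Ck_on_SucD[OF assms(1) assms(3)[unfolded k']]
  have D: "(P has_real_derivative inverse (deriv g (P y))) (at y)" if y: "y \<in> B" for y
  proof -
    obtain d where d: "d > 0" "ball y d \<subseteq> B"
      using openE[OF assms(2) y] .
    show ?thesis
    proof (rule DERIV_inverse_function)
      show "(g has_real_derivative deriv g (P y)) (at (P y))" "deriv g (P y) \<noteq> 0"
        using y assms(5,6) g(1) by blast+
      show "y - d < y" "y < y + d" using d(1) by simp_all
      show "g (P z) = z" if "y - d < z" "z < y + d" for z
        using that d(2) by (intro assms(7)) (auto simp: ball_eq_greaterThanLessThan)
      show "isCont P y" using assms(2,8) y by (simp add: continuous_on_eq_continuous_at)
    qed
  qed
  have "Ck_on j B P" if "j \<le> k" for j
    using that
  proof (induction j)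
    case 0
    then show ?case by (simp add: Ck_on_0 assms(8))
  next
    case (Suc j)
    show ?case
    proof (rule Ck_on_SucI'[OF assms(2) D])
      have "Ck_on j A (deriv g)" by (rule Ck_on_mono[OF g(2)]) (use Suc.prems in \<open>simp add: k'\<close>)
      then have "Ck_on j B (\<lambda>y. deriv g (P y))"
        by (rule Ck_on_compose[OF assms(2,1)]) (use Suc assms(6) in auto)
      then show "Ck_on j B (\<lambda>y. inverse (deriv g (P y)))"
        by (rule Ck_on_inverse[OF assms(2)]) (simp add: assms(5,6))
    qed
  qed
  then show ?thesis by simp
qed

lemma Ck_on_ident:
  assumes "open S"
  shows "Ck_on k S (\<lambda>x. x)"
proof (cases k)
  case (Suc j)
  show ?thesis
    unfolding Suc by (rule Ck_on_SucI'[OF assms DERIV_ident Ck_on_const])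
qed (simp add: Ck_on_0)

text \<open>A positive derivative on the closed interval makes \<open>g\<close> strictly increasing
  up to both endpoints, and the intermediate value theorem identifies the image. The smoothness of
  the inverse is then bootstrapped from its continuity.\<close>

lemma Ck_diffeo_inv_into:
  fixes g :: "real \<Rightarrow> real"
  assumes "0 < R" "k \<ge> 1" "Ck_on k {0<..<R} g" "g 0 = 0"
    and deriv: "\<And>u. 0 \<le> u \<Longrightarrow> u \<le> R \<Longrightarrow> (g has_real_derivative w u) (at u)"
    and pos: "\<And>u. 0 \<le> u \<Longrightarrow> u \<le> R \<Longrightarrow> w u > 0"
  defines "P \<equiv> inv_into {0<..<R} g"
  shows "P ` {0<..<g R} = {0<..<R}" "\<And>e. e \<in> {0<..<g R} \<Longrightarrow> g (P e) = e"
    and "strict_mono_on {0<..<g R} P" "Ck_diffeo_onto_image k {0<..<g R} P"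
proof -
  have less: "g a < g b" if "0 \<le> a" "a < b" "b \<le> R" for a b
  proof (rule DERIV_pos_imp_increasing[OF that(2)])
    fix u assume "a \<le> u" "u \<le> b"
    then have "0 \<le> u" "u \<le> R" using that by auto
    then show "\<exists>y. (g has_real_derivative y) (at u) \<and> y > 0" using deriv pos by blast
  qed
  have img: "g ` {0<..<R} = {0<..<g R}"
  proof (intro equalityI subsetI)
    fix e assume "e \<in> g ` {0<..<R}"
    then obtain u where "0 < u" "u < R" "e = g u" by auto
    then show "e \<in> {0<..<g R}" using less[of 0 u] less[of u R] assms(4) by simp
  next
    fix e assume e: "e \<in> {0<..<g R}"
    have "continuous_on {0..R} g"
      using deriv by (intro DERIV_continuous_on) (auto intro: has_field_derivative_at_within)
    then obtain u where u: "0 \<le> u" "u \<le> R" "g u = e"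
      using IVT'[of g 0 e R] e assms(1,4) by auto
    then have "u \<noteq> 0" "u \<noteq> R" using e assms(4) by auto
    with u show "e \<in> g ` {0<..<R}" by auto
  qed
  have inj: "inj_on g {0<..<R}"
  proof (rule inj_onI)
    fix a b assume "a \<in> {0<..<R}" "b \<in> {0<..<R}" "g a = g b"
    then show "a = b" using less[of a b] less[of b a] by (cases a b rule: linorder_cases) auto
  qed
  have bij: "bij_betw P {0<..<g R} {0<..<R}"
    unfolding P_def using inj img by (intro bij_betw_inv_into) (simp add: bij_betw_def)
  show P_img: "P ` {0<..<g R} = {0<..<R}" using bij by (simp add: bij_betw_def)
  then have P_in: "P e \<in> {0<..<R}" if "e \<in> {0<..<g R}" for e using that by blast
  show gP: "g (P e) = e" if "e \<in> {0<..<g R}" for e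
    unfolding P_def using that img by (simp add: f_inv_into_f)
  show mono: "strict_mono_on {0<..<g R} P"
  proof (rule strict_mono_onI)
    fix a b assume ab: "a \<in> {0<..<g R}" "b \<in> {0<..<g R}" "a < b"
    show "P a < P b"
    proof (rule ccontr)
      assume "\<not> P a < P b"
      then have "g (P b) \<le> g (P a)"
        using less[of "P b" "P a"] P_in[OF ab(1)] P_in[OF ab(2)] by (cases "P a = P b") auto
      then show False using ab gP by simp
    qed
  qed
  \<comment> \<open>A monotone function with open image has no jumps.\<close>
  have cont: "continuous_on {0<..<g R} P"
  proof (rule continuous_onI_mono)
    show "P a \<le> P b" if "a \<in> {0<..<g R}" "b \<in> {0<..<g R}" "a \<le> b" for a b
      using strict_mono_onD[OF mono that(1,2)] that(3) by (cases "a = b") auto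
  qed (simp add: P_img)
  have "Ck_on k {0<..<g R} P"
  proof (rule Ck_on_inverse_function[OF _ _ assms(3,2) _ P_in gP cont])
    fix u assume "u \<in> {0<..<R}"
    then have "0 \<le> u" "u \<le> R" by auto
    then show "deriv g u \<noteq> 0" using DERIV_imp_deriv[OF deriv[of u]] pos[of u] by simp
  qed simp_all
  \<comment> \<open>On \<open>{0<..<R}\<close> the inverse of \<open>P\<close> is \<open>g\<close>
    again.\<close>
  moreover have "Ck_on k {0<..<R} (inv_into {0<..<g R} P)"
  proof (rule Ck_on_cong[OF _ _ assms(3)])
    fix u assume "u \<in> {0<..<R}"
    then have "P (g u) = u" "g u \<in> {0<..<g R}"
      unfolding P_def img[symmetric] by (simp_all add: inv_into_f_f[OF inj])
    then show "g u = inv_into {0<..<g R} P u"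
      using inv_into_f_f[OF bij_betw_imp_inj_on[OF bij]] by metis
  qed simp
  ultimately show "Ck_diffeo_onto_image k {0<..<g R} P"
    unfolding Ck_diffeo_onto_image_def P_img using bij by (simp add: bij_betw_def)
qed

subsection \<open>Substituting programs for queries\<close>

text \<open>The body \<open>g\<close> only has to halt up to some zero \<open>n\<close> of
  \<open>t\<close>. This allows searches whose body may be undefined further on.\<close>

lemma eval_Mu_Least:
  assumes "\<And>i. i \<le> n \<Longrightarrow> eval \<phi> g (i # xs) (t i)" "t n = 0"
  shows "eval \<phi> (Mu g) xs (LEAST i. t i = 0)"
proof (rule eval_Mu)
  let ?m = "LEAST i. t i = 0"
  have le: "?m \<le> n" using assms(2) by (rule Least_le)
  have "t ?m = 0" using assms(2) by (rule LeastI)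
  with assms(1)[OF le] show "eval \<phi> g (?m # xs) 0" by simp
  fix i assume i: "i < ?m"
  then have "t i \<noteq> 0" using not_less_Least by blast
  then obtain y where "t i = Suc y" using not0_implies_Suc by blast
  with assms(1)[of i] i le have "eval \<phi> g (i # xs) (Suc y)" by simp
  then show "\<exists>y. eval \<phi> g (i # xs) (Suc y)" ..
qed

text \<open>Every call of \<open>Query\<close> is replaced by the program \<open>q\<close>, which depends on \<open>k\<close> parameters.
  These are carried behind the \<open>n\<close> proper arguments, where the schemes of recursion and
  minimization, which act on the first argument, leave them alone.\<close>

fun subst_query :: "prog \<Rightarrow> nat \<Rightarrow> nat \<Rightarrow> prog \<Rightarrow> prog" where
  "subst_query q k n Zero = Zero"
| "subst_query q k n Succ = Succ"
| "subst_query q k n (Proj i) = Proj i"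
| "subst_query q k n Query = Comp q (Proj 0 # map Proj [n..<n + k])"
| "subst_query q k n (Comp h gs) =
     Comp (subst_query q k (length gs) h) (map (subst_query q k n) gs @ map Proj [n..<n + k])"
| "subst_query q k n (PrimRec g h) =
     PrimRec (subst_query q k (n - 1) g) (subst_query q k (Suc n) h)"
| "subst_query q k n (Mu g) = Mu (subst_query q k (Suc n) g)"

text \<open>Induction on the run of \<open>p\<close>: the parameters \<open>ps\<close> are handed to
  every subprogram, and each answer of \<open>\<phi>'\<close> is computed by \<open>q\<close>. The
  oracle \<open>\<phi>\<close> of the new program is arbitrary.\<close>

lemma eval_subst_query:
  assumes "eval \<phi>' p xs z" "\<And>t. eval \<phi> q (t # ps) (\<phi>' t)"
  shows "eval \<phi> (subst_query q (length ps) (length xs) p) (xs @ ps) z"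
proof -
  \<comment> \<open>The projections past the proper arguments \<open>ys\<close> recover the
    parameters.\<close>
  have params: "list_all2 (\<lambda>g y. eval \<phi> g (ys @ ps) y)
      (map Proj [length ys..<length ys + length ps]) ps" for ys
  proof (rule list_all2_all_nthI)
    fix i assume "i < length (map Proj [length ys..<length ys + length ps])"
    then have i: "i < length ps" by simp
    have "eval \<phi> (Proj (length ys + i)) (ys @ ps) ((ys @ ps) ! (length ys + i))"
      by (rule eval_Proj) (simp add: i)
    with i show "eval \<phi> (map Proj [length ys..<length ys + length ps] ! i) (ys @ ps) (ps ! i)"
      by simp
  qed simp
  show ?thesis
    using assms(1)
  proof (induction rule: eval.induct)
    case (eval_Proj i xs)
    then have "eval \<phi> (Proj i) (xs @ ps) ((xs @ ps) ! i)" by (intro eval.eval_Proj) simp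
    with eval_Proj show ?case by (simp add: nth_append)
  next
    case (eval_Query n xs)
    have "eval \<phi> (Proj 0) ((n # xs) @ ps) n"
      using eval.eval_Proj[of 0 "(n # xs) @ ps"] by simp
    then have "list_all2 (\<lambda>g y. eval \<phi> g ((n # xs) @ ps) y)
        (Proj 0 # map Proj [length (n # xs)..<length (n # xs) + length ps]) (n # ps)"
      using params[of "n # xs"] by simp
    then show ?case
      unfolding subst_query.simps by (rule eval.eval_Comp) (rule assms(2))
  next
    case (eval_Comp xs gs ys h z)
    have len: "length gs = length ys" using list_all2_lengthD[OF eval_Comp.IH(1)] .
    have "list_all2 (\<lambda>g y. eval \<phi> g (xs @ ps) y)
        (map (subst_query q (length ps) (length xs)) gs) ys"
      unfolding list.rel_map by (rule list_all2_mono[OF eval_Comp.IH(1)]) simp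
    then have "list_all2 (\<lambda>g y. eval \<phi> g (xs @ ps) y)
        (map (subst_query q (length ps) (length xs)) gs
          @ map Proj [length xs..<length xs + length ps]) (ys @ ps)"
      by (rule list_all2_appendI) (rule params)
    then show ?case
      using eval_Comp.IH(2) len by (auto intro: eval.eval_Comp)
  next
    case (eval_Mu g n xs)
    show ?case
      unfolding subst_query.simps
    proof (rule eval.eval_Mu)
      fix i assume "i < n"
      then show "\<exists>y. eval \<phi> (subst_query q (length ps) (Suc (length xs)) g) (i # xs @ ps) (Suc y)"
        using eval_Mu.IH(2)[of i] by auto
    qed (use eval_Mu.IH(1) in simp)
  qed (auto intro: eval.intros)
qed

subsection \<open>Recursive functions on numbers and integers\<close>

text \<open>One program gives the same value for every oracle, so it can be used inside any
  computation with queries.\<close>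

definition recursive :: "nat \<Rightarrow> (nat list \<Rightarrow> nat) \<Rightarrow> bool" where
  "recursive k F \<longleftrightarrow> (\<exists>p. \<forall>\<phi> xs. length xs = k \<longrightarrow> eval \<phi> p xs (F xs))"

lemma recursive_cong:
  assumes "recursive k F" "\<And>xs. length xs = k \<Longrightarrow> F xs = G xs"
  shows "recursive k G"
  using assms unfolding recursive_def by metis

lemma recursive_nth: "i < k \<Longrightarrow> recursive k (\<lambda>xs. xs ! i)"
  unfolding recursive_def using eval_Proj by blast

lemma recursive_comp1:
  assumes "recursive 1 (\<lambda>xs. h (xs ! 0))" "recursive k F"
  shows "recursive k (\<lambda>xs. h (F xs))"
proof -
  obtain p where p: "\<And>\<phi> xs. length xs = 1 \<Longrightarrow> eval \<phi> p xs (h (xs ! 0))"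
    using assms(1) unfolding recursive_def by blast
  obtain q where q: "\<And>\<phi> xs. length xs = k \<Longrightarrow> eval \<phi> q xs (F xs)"
    using assms(2) unfolding recursive_def by blast
  have "eval \<phi> (Comp p [q]) xs (h (F xs))" if "length xs = k" for \<phi> xs
    using q[OF that] p[of "[F xs]"] by (auto intro!: eval_Comp[where ys = "[F xs]"])
  then show ?thesis unfolding recursive_def by blast
qed

lemma recursive_comp2:
  assumes "recursive 2 (\<lambda>xs. h (xs ! 0) (xs ! 1))" "recursive k F" "recursive k G"
  shows "recursive k (\<lambda>xs. h (F xs) (G xs))"
proof -
  obtain p where p: "\<And>\<phi> xs. length xs = 2 \<Longrightarrow> eval \<phi> p xs (h (xs ! 0) (xs ! 1))"
    using assms(1) unfolding recursive_def by blast
  obtain q where q: "\<And>\<phi> xs. length xs = k \<Longrightarrow> eval \<phi> q xs (F xs)"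
    using assms(2) unfolding recursive_def by blast
  obtain r where r: "\<And>\<phi> xs. length xs = k \<Longrightarrow> eval \<phi> r xs (G xs)"
    using assms(3) unfolding recursive_def by blast
  have "eval \<phi> (Comp p [q, r]) xs (h (F xs) (G xs))" if "length xs = k" for \<phi> xs
    using q[OF that] r[OF that] p[of "[F xs, G xs]"]
    by (auto intro!: eval_Comp[where ys = "[F xs, G xs]"])
  then show ?thesis unfolding recursive_def by blast
qed

lemma recursive_primrec:
  assumes "recursive 1 (\<lambda>xs. g (xs ! 0))" "recursive 3 (\<lambda>xs. h (xs ! 0) (xs ! 1) (xs ! 2))"
    and "\<And>b. f 0 b = g b" "\<And>a b. f (Suc a) b = h a (f a b) b"
  shows "recursive 2 (\<lambda>xs. f (xs ! 0) (xs ! 1))"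
proof -
  obtain p where p: "\<And>\<phi> xs. length xs = 1 \<Longrightarrow> eval \<phi> p xs (g (xs ! 0))"
    using assms(1) unfolding recursive_def by blast
  obtain q where
    q: "\<And>\<phi> xs. length xs = 3 \<Longrightarrow> eval \<phi> q xs (h (xs ! 0) (xs ! 1) (xs ! 2))"
    using assms(2) unfolding recursive_def by blast
  have rec: "eval \<phi> (PrimRec p q) [a, b] (f a b)" for \<phi> a b
  proof (induction a)
    case 0
    show ?case using p[of "[b]"] by (auto intro: eval_PrimRec_0 simp: assms(3))
  next
    case (Suc a)
    show ?case using q[of "[a, f a b, b]"] eval_PrimRec_Suc[OF Suc]
      by (simp add: assms(4))
  qed
  have "eval \<phi> (PrimRec p q) xs (f (xs ! 0) (xs ! 1))" if len: "length xs = 2" for \<phi> xs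
  proof -
    obtain a b where "xs = [a, b]" using len by (auto simp: numeral_2_eq_2 length_Suc_conv)
    then show ?thesis using rec by simp
  qed
  then show ?thesis unfolding recursive_def by blast
qed

lemma recursive_Least:
  assumes "recursive (Suc k) F" "\<And>xs. length xs = k \<Longrightarrow> \<exists>n. F (n # xs) = 0"
  shows "recursive k (\<lambda>xs. LEAST n. F (n # xs) = 0)"
proof -
  obtain p where p: "\<And>\<phi> xs. length xs = Suc k \<Longrightarrow> eval \<phi> p xs (F xs)"
    using assms(1) unfolding recursive_def by blast
  have "eval \<phi> (Mu p) xs (LEAST n. F (n # xs) = 0)" if len: "length xs = k" for \<phi> xs
  proof -
    obtain n where "F (n # xs) = 0" using assms(2)[OF len] ..
    then show ?thesis
      by (intro eval_Mu_Least[of n, where t = "\<lambda>n. F (n # xs)"] p) (simp_all add: len)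
  qed
  then show ?thesis unfolding recursive_def by blast
qed

section \<open>Arithmetic on natural numbers\<close>

lemma recursive_Suc:
  assumes "recursive k F"
  shows "recursive k (\<lambda>xs. Suc (F xs))"
proof (rule recursive_comp1[OF _ assms])
  have "eval \<phi> Succ xs (Suc (xs ! 0))" if "length xs = 1" for \<phi> xs
    using that eval_Succ by (cases xs) auto
  then show "recursive 1 (\<lambda>xs. Suc (xs ! 0))" unfolding recursive_def by blast
qed

lemma recursive_const: "recursive k (\<lambda>_. c)"
proof (induction c)
  case 0
  show ?case unfolding recursive_def using eval_Zero by blast
qed (rule recursive_Suc)

lemma recursive_add:
  assumes "recursive k F" "recursive k G"
  shows "recursive k (\<lambda>xs. F xs + G xs)"
proof (rule recursive_comp2[OF _ assms])
  show "recursive 2 (\<lambda>xs. xs ! 0 + xs ! 1)"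
    by (rule recursive_primrec[where g = "\<lambda>b. b" and h = "\<lambda>a y b. Suc y"])
      (simp_all add: recursive_nth recursive_Suc)
qed

lemma recursive_mult:
  assumes "recursive k F" "recursive k G"
  shows "recursive k (\<lambda>xs. F xs * G xs)"
proof (rule recursive_comp2[OF _ assms])
  show "recursive 2 (\<lambda>xs. xs ! 0 * xs ! 1)"
    by (rule recursive_primrec[where g = "\<lambda>b. 0" and h = "\<lambda>a y b. b + y"])
      (simp_all add: recursive_nth recursive_const recursive_add)
qed

lemma recursive_diff:
  assumes "recursive k F" "recursive k G"
  shows "recursive k (\<lambda>xs. F xs - G xs)"
proof -
  \<comment> \<open>The recursion rule yields binary functions, so the predecessor carries a dummy
    second argument.\<close>
  have pred: "recursive k (\<lambda>xs. F xs - 1)" if "recursive k F" for k F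
  proof (rule recursive_comp2[where h = "\<lambda>a b. a - 1", OF _ that that])
    show "recursive 2 (\<lambda>xs. xs ! 0 - 1)"
      by (rule recursive_primrec[where f = "\<lambda>a b. a - 1" and g = "\<lambda>b. 0" and h = "\<lambda>a y b. a"])
        (simp_all add: recursive_nth recursive_const)
  qed
  \<comment> \<open>Truncated subtraction recurses on the subtrahend, which therefore has to come
    first; the arguments are swapped back afterwards.\<close>
  have "recursive 2 (\<lambda>xs. xs ! 1 - xs ! 0)"
    by (rule recursive_primrec[where f = "\<lambda>a b. b - a" and g = "\<lambda>b. b" and h = "\<lambda>a y b. y - 1"])
      (use pred in \<open>simp_all add: recursive_nth\<close>)
  then show ?thesis
    by (rule recursive_comp2[where h = "\<lambda>a b. b - a"]) (rule assms)+
qed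

lemma recursive_power2:
  assumes "recursive k F"
  shows "recursive k (\<lambda>xs. 2 ^ F xs)"
proof (rule recursive_comp2[where h = "\<lambda>a b. 2 ^ a", OF _ assms assms])
  show "recursive 2 (\<lambda>xs. 2 ^ (xs ! 0))"
    by (rule recursive_primrec[where f = "\<lambda>a b. 2 ^ a" and g = "\<lambda>b. 1" and h = "\<lambda>a y b. y + y"])
      (simp_all add: recursive_nth recursive_const recursive_add)
qed

text \<open>The quotient is the least \<open>n\<close> with \<open>a < Suc n * b\<close>, an
  inequality expressed by a vanishing truncated difference.\<close>

lemma recursive_div:
  assumes "recursive k F" "recursive k G" "\<And>xs. length xs = k \<Longrightarrow> G xs > 0"
  shows "recursive k (\<lambda>xs. F xs div G xs)"
proof -
  text \<open>Replacing the divisor \<open>b\<close> by \<open>b + (1 - b)\<close> makes the minimization total.\<close>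
  define D where "D = (\<lambda>a b. LEAST n. Suc a - Suc n * (b + (1 - b)) = (0::nat))"
  have D: "D a b = a div b" if "b > 0" for a b
    unfolding D_def
  proof (rule Least_equality)
    have "a < Suc (a div b) * b" using dividend_less_div_times[OF that, of a] by simp
    then show "Suc a - Suc (a div b) * (b + (1 - b)) = 0" using that by simp
  next
    fix n assume "Suc a - Suc n * (b + (1 - b)) = 0"
    then have "a < Suc n * b" using that by simp
    then show "a div b \<le> n" using less_mult_imp_div_less less_Suc_eq_le by blast
  qed
  have "recursive 2 (\<lambda>xs. LEAST n. Suc ((n # xs) ! 1) -
      Suc ((n # xs) ! 0) * ((n # xs) ! 2 + (1 - (n # xs) ! 2)) = 0)"
  proof (rule recursive_Least)
    fix xs :: "nat list"
    have "Suc a \<le> Suc a * (b + (1 - b))" for a b :: nat by (cases b) auto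
    then show "\<exists>n. Suc ((n # xs) ! 1) -
        Suc ((n # xs) ! 0) * ((n # xs) ! 2 + (1 - (n # xs) ! 2)) = 0"
      by (intro exI[of _ "xs ! 0"]) simp
  qed (intro recursive_diff recursive_Suc recursive_mult recursive_add recursive_const
      recursive_nth; simp)
  then have "recursive 2 (\<lambda>xs. D (xs ! 0) (xs ! 1))"
    by (rule recursive_cong) (simp add: D_def)
  then have "recursive k (\<lambda>xs. D (F xs) (G xs))"
    by (rule recursive_comp2) (rule assms)+
  then show ?thesis
    by (rule recursive_cong) (simp add: D assms(3))
qed

lemmas recursive_intros = recursive_nth recursive_const recursive_Suc recursive_add recursive_mult
  recursive_diff recursive_power2

text \<open>Representing an integer as a difference of naturals gives the ring operations without
  any coding; \<open>int_encode\<close> and \<open>int_decode\<close> are only needed at the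
  interface with \<open>eval\<close>.\<close>

definition recursive_int :: "nat \<Rightarrow> (nat list \<Rightarrow> int) \<Rightarrow> bool" where
  "recursive_int k F \<longleftrightarrow> (\<exists>A B. recursive k A \<and> recursive k B \<and>
     (\<forall>xs. length xs = k \<longrightarrow> F xs = int (A xs) - int (B xs)))"

lemma recursive_intI:
  assumes "recursive k A" "recursive k B"
    and "\<And>xs. length xs = k \<Longrightarrow> F xs = int (A xs) - int (B xs)"
  shows "recursive_int k F"
  using assms unfolding recursive_int_def by blast

lemma recursive_int_of_nat: "recursive k F \<Longrightarrow> recursive_int k (\<lambda>xs. int (F xs))"
  by (rule recursive_intI[where B = "\<lambda>_. 0"]) (simp_all add: recursive_const)

lemma recursive_int_const: "recursive_int k (\<lambda>xs. c)"
  by (rule recursive_intI[where A = "\<lambda>_. nat c" and B = "\<lambda>_. nat (- c)"])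
    (simp_all add: recursive_const)

lemma recursive_int_add:
  assumes "recursive_int k F" "recursive_int k G"
  shows "recursive_int k (\<lambda>xs. F xs + G xs)"
proof -
  obtain A B where F: "recursive k A" "recursive k B"
    "\<And>xs. length xs = k \<Longrightarrow> F xs = int (A xs) - int (B xs)"
    using assms(1) unfolding recursive_int_def by blast
  obtain C D where G: "recursive k C" "recursive k D"
    "\<And>xs. length xs = k \<Longrightarrow> G xs = int (C xs) - int (D xs)"
    using assms(2) unfolding recursive_int_def by blast
  show ?thesis
    by (rule recursive_intI[OF recursive_add[OF F(1) G(1)] recursive_add[OF F(2) G(2)]])
      (simp add: F(3) G(3))
qed

lemma recursive_int_mult:
  assumes "recursive_int k F" "recursive_int k G"
  shows "recursive_int k (\<lambda>xs. F xs * G xs)"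
proof -
  obtain A B where F: "recursive k A" "recursive k B"
    "\<And>xs. length xs = k \<Longrightarrow> F xs = int (A xs) - int (B xs)"
    using assms(1) unfolding recursive_int_def by blast
  obtain C D where G: "recursive k C" "recursive k D"
    "\<And>xs. length xs = k \<Longrightarrow> G xs = int (C xs) - int (D xs)"
    using assms(2) unfolding recursive_int_def by blast
  show ?thesis
  proof (rule recursive_intI)
    show "recursive k (\<lambda>xs. A xs * C xs + B xs * D xs)" "recursive k (\<lambda>xs. A xs * D xs + B xs * C xs)"
      by (intro recursive_intros F G)+
  qed (simp add: F(3) G(3) algebra_simps)
qed

lemma recursive_int_diff:
  assumes "recursive_int k F" "recursive_int k G"
  shows "recursive_int k (\<lambda>xs. F xs - G xs)"
  using recursive_int_add[OF assms(1) recursive_int_mult[OF recursive_int_const[of _ "-1"] assms(2)]]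
  by simp

text \<open>An even code \<open>2 m\<close> stands for \<open>m\<close> and an odd code
  \<open>2 m + 1\<close> for \<open>- (m + 1)\<close>. The term \<open>F xs - 2 * h (F xs)\<close>
  is the parity bit that selects the case.\<close>

lemma recursive_int_decode:
  assumes "recursive k F"
  shows "recursive_int k (\<lambda>xs. int_decode (F xs))"
proof -
  define h where "h = (\<lambda>c::nat. c div 2)"
  have h: "recursive k (\<lambda>xs. h (F xs))"
    unfolding h_def by (intro recursive_div recursive_const assms) simp
  show ?thesis
  proof (rule recursive_intI)
    show "recursive k (\<lambda>xs. h (F xs) * (1 - (F xs - 2 * h (F xs))))"
      "recursive k (\<lambda>xs. Suc (h (F xs)) * (F xs - 2 * h (F xs)))"
      by (intro recursive_intros assms h)+
    fix xs
    show "int_decode (F xs) = int (h (F xs) * (1 - (F xs - 2 * h (F xs)))) -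
        int (Suc (h (F xs)) * (F xs - 2 * h (F xs)))"
    proof (cases "even (F xs)")
      case True
      then show ?thesis by (simp add: int_decode_def sum_decode_def h_def)
    next
      case False
      then have "F xs - 2 * h (F xs) = 1" by (auto simp: h_def elim: oddE)
      with False show ?thesis by (simp add: int_decode_def sum_decode_def h_def)
    qed
  qed
qed

text \<open>Of the two truncated differences at most one is nonzero. A negative number
  \<open>- m\<close> has code \<open>2 m - 1\<close>, and the truncated \<open>- 1\<close> has no
  effect in the other case.\<close>

lemma recursive_int_encode:
  assumes "recursive_int k F"
  shows "recursive k (\<lambda>xs. int_encode (F xs))"
proof -
  obtain A B where F: "recursive k A" "recursive k B"
    "\<And>xs. length xs = k \<Longrightarrow> F xs = int (A xs) - int (B xs)"
    using assms(1) unfolding recursive_int_def by blast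
  have "recursive k (\<lambda>xs. 2 * (A xs - B xs) + (2 * (B xs - A xs) - 1))"
    by (intro recursive_intros F)
  then show ?thesis
  proof (rule recursive_cong)
    fix xs :: "nat list" assume xs: "length xs = k"
    show "2 * (A xs - B xs) + (2 * (B xs - A xs) - 1) = int_encode (F xs)"
      unfolding F(3)[OF xs] int_encode_def sum_encode_def by (auto simp: nat_diff_distrib)
  qed
qed

lemma recursive_nat_abs:
  assumes "recursive_int k F"
  shows "recursive k (\<lambda>xs. nat \<bar>F xs\<bar>)"
proof -
  obtain A B where F: "recursive k A" "recursive k B"
    "\<And>xs. length xs = k \<Longrightarrow> F xs = int (A xs) - int (B xs)"
    using assms(1) unfolding recursive_int_def by blast
  have "recursive k (\<lambda>xs. (A xs - B xs) + (B xs - A xs))"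
    by (intro recursive_intros F)
  then show ?thesis
    by (rule recursive_cong) (simp add: F(3))
qed

text \<open>Division rounds down, so for a negative numerator the quotient is minus a ceiling,
  computed as \<open>(n + d - 1) div d\<close>. In either case one of the two natural quotients is
  zero.\<close>

lemma recursive_int_div:
  assumes "recursive_int k F" "recursive k G" "\<And>xs. length xs = k \<Longrightarrow> G xs > 0"
  shows "recursive_int k (\<lambda>xs. F xs div int (G xs))"
proof -
  obtain A B where F: "recursive k A" "recursive k B"
    "\<And>xs. length xs = k \<Longrightarrow> F xs = int (A xs) - int (B xs)"
    using assms(1) unfolding recursive_int_def by blast
  show ?thesis
  proof (rule recursive_intI)
    show "recursive k (\<lambda>xs. (A xs - B xs) div G xs)"
      "recursive k (\<lambda>xs. ((B xs - A xs) + (G xs - 1)) div G xs)"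
      by (intro recursive_div recursive_intros F assms; assumption)+
    fix xs :: "nat list" assume xs: "length xs = k"
    note pos = assms(3)[OF xs]
    show "F xs div int (G xs) =
        int ((A xs - B xs) div G xs) - int (((B xs - A xs) + (G xs - 1)) div G xs)"
    proof (cases "B xs \<le> A xs")
      case True
      then show ?thesis using pos by (simp add: F(3)[OF xs] zdiv_int of_nat_diff)
    next
      case False
      define n d where "n = int (B xs) - int (A xs)" and "d = int (G xs)"
      have d: "d > 0" using pos by (simp add: d_def)
      have "(- n) div d = - ((n + d - 1) div d)"
      proof (rule int_div_pos_eq[where r = "d - 1 - (n + d - 1) mod d"])
        show "- n = d * - ((n + d - 1) div d) + (d - 1 - (n + d - 1) mod d)"
          using mult_div_mod_eq[of d "n + d - 1"] by (simp add: algebra_simps)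
      qed (use d pos_mod_bound[OF d, of "n + d - 1"] pos_mod_sign[OF d, of "n + d - 1"] in auto)
      with False pos show ?thesis
        by (simp add: F(3)[OF xs] n_def d_def zdiv_int of_nat_diff algebra_simps)
    qed
  qed
qed

subsection \<open>Computing the inverse of an increment\<close>

lemma encodes_real_iff:
  "encodes_real \<phi> x \<longleftrightarrow> (\<forall>n. \<bar>real_of_int (int_decode (\<phi> n)) - 2 ^ n * x\<bar> \<le> 1)"
proof -
  have "\<bar>a / 2 ^ n - x\<bar> \<le> 1 / 2 ^ n \<longleftrightarrow> \<bar>a - 2 ^ n * x\<bar> \<le> 1" for a :: real and n
  proof -
    have "a / 2 ^ n - x = (a - 2 ^ n * x) / 2 ^ n" by (simp add: field_simps)
    then show ?thesis by (simp add: abs_divide divide_le_cancel)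
  qed
  then show ?thesis unfolding encodes_real_def by simp
qed

text \<open>Rounding down at precision \<open>t\<close> is harmless because the numerator read from \<open>X\<close> has
  \<open>N + 1\<close> more bits and only that last unit is uncertain.\<close>

lemma encodes_real_affine:
  fixes s :: int
  assumes "encodes_real X x"
  shows "encodes_real
    (\<lambda>t. int_encode ((int_decode (X (t + N + 1)) + s * int i * int (2 ^ (t + 1))) div int (2 ^ (N + 1))))
    (x + s * (i / 2 ^ N))"
  unfolding encodes_real_iff
proof
  fix t
  define y where "y = x + s * (i / 2 ^ N)"
  define K where "K = int_decode (X (t + N + 1)) + s * int i * int (2 ^ (t + 1))"
  define D :: int where "D = 2 ^ (N + 1)"
  have D: "D > 0" by (simp add: D_def)
  have "2 ^ (t + N + 1) * y = 2 ^ (t + N + 1) * x + s * i * 2 ^ (t + 1)"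
    by (simp add: y_def field_simps power_add)
  moreover have "\<bar>int_decode (X (t + N + 1)) - 2 ^ (t + N + 1) * x\<bar> \<le> 1"
    using assms unfolding encodes_real_iff by blast
  ultimately have K: "\<bar>K - 2 ^ (t + N + 1) * y\<bar> \<le> 1"
    by (simp add: K_def)
  have "K = D * (K div D) + K mod D" by simp
  then have K': "real_of_int K = D * real_of_int (K div D) + real_of_int (K mod D)"
    by (metis of_int_add of_int_mult)
  \<comment> \<open>Rounding loses at most \<open>D - 1\<close>. With the error 1 of
    \<open>K\<close> this makes \<open>D\<close>, one unit after division by
    \<open>D\<close>.\<close>
  have m: "0 \<le> real_of_int (K mod D)" "real_of_int (K mod D) \<le> D - 1"
    using pos_mod_bound[OF D, of K] pos_mod_sign[OF D, of K] by linarith+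
  have "D * (real_of_int (K div D) - 2 ^ t * y) =
      real_of_int K - real_of_int (K mod D) - 2 ^ (t + N + 1) * y"
    unfolding K' by (simp add: D_def algebra_simps power_add)
  moreover have "real_of_int D \<ge> 1" using D by linarith
  ultimately have "\<bar>D * (real_of_int (K div D) - 2 ^ t * y)\<bar> \<le> D"
    using K m by linarith
  then have "\<bar>real_of_int (K div D) - 2 ^ t * y\<bar> \<le> 1"
    using D by (simp add: abs_mult)
  then show "\<bar>int_decode (int_encode ((int_decode (X (t + N + 1)) + s * int i * int (2 ^ (t + 1)))
      div int (2 ^ (N + 1)))) - 2 ^ t * (x + s * (i / 2 ^ N))\<bar> \<le> 1"
    by (simp add: K_def D_def y_def)
qed

lemma eval_Comp1: "eval \<phi> g xs a \<Longrightarrow> eval \<phi> h [a] z \<Longrightarrow> eval \<phi> (Comp h [g]) xs z"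
  by (rule eval_Comp[where ys = "[a]"]) auto

lemma eval_Comp3:
  "eval \<phi> g1 xs a \<Longrightarrow> eval \<phi> g2 xs b \<Longrightarrow> eval \<phi> g3 xs c \<Longrightarrow> eval \<phi> h [a, b, c] z \<Longrightarrow>
    eval \<phi> (Comp h [g1, g2, g3]) xs z"
  by (rule eval_Comp[where ys = "[a, b, c]"]) auto

text \<open>Substituting \<open>Zero\<close> for the queries turns a program run with the zero
  oracle into one that works with any oracle.\<close>

lemma computable_real_imp_recursive:
  assumes "computable_real x"
  obtains X where "encodes_real X x" "recursive 1 (\<lambda>xs. X (xs ! 0))"
proof -
  obtain p X where X: "encodes_real X x" "\<And>n. eval (\<lambda>_. 0) p [n] (X n)"
    using assms unfolding computable_real_def by blast
  have "eval \<phi> (subst_query Zero 0 1 p) xs (X (xs ! 0))" if "length xs = 1" for \<phi> xs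
    using that eval_subst_query[OF X(2), of \<phi> Zero "[]" "xs ! 0"] eval_Zero
    by (cases xs) auto
  then have "recursive 1 (\<lambda>xs. X (xs ! 0))" unfolding recursive_def by blast
  with X(1) that show ?thesis by blast
qed

text \<open>The queries of the program for \<open>f\<close> are answered by a program that
  approximates \<open>x + s * (i / 2 ^ N)\<close>, with \<open>i\<close> and \<open>N\<close> as
  parameters. The oracle thus stays free to supply \<open>\<epsilon>\<close> later.\<close>

lemma computable_on_dyadic_translates:
  fixes s :: int
  assumes "computable_real_fun_on U f" "computable_real x"
  defines "y \<equiv> \<lambda>(i::nat) (N::nat). x + s * (i / 2 ^ N)"
  obtains p \<Psi> where
    "\<And>i N. y i N \<in> U \<Longrightarrow> encodes_real (\<Psi> i N) (f (y i N))"
    "\<And>i N \<phi> n. y i N \<in> U \<Longrightarrow> eval \<phi> p [n, i, N] (\<Psi> i N n)"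
proof -
  obtain pf where pf: "\<And>y \<phi>. y \<in> U \<Longrightarrow> encodes_real \<phi> y \<Longrightarrow>
      \<exists>\<psi>. encodes_real \<psi> (f y) \<and> (\<forall>n. eval \<phi> pf [n] (\<psi> n))"
    using assms(1) unfolding computable_real_fun_on_def by blast
  obtain X where X: "encodes_real X x" "recursive 1 (\<lambda>xs. X (xs ! 0))"
    using assms(2) by (rule computable_real_imp_recursive)
  define Y where "Y = (\<lambda>t i N. int_encode ((int_decode (X (t + N + 1)) + s * int i * int (2 ^ (t + 1)))
    div int (2 ^ (N + 1))))"
  have "recursive 3 (\<lambda>xs. Y (xs ! 0) (xs ! 1) (xs ! 2))"
    unfolding Y_def
    by (intro recursive_int_encode recursive_int_div recursive_int_add recursive_int_mult
        recursive_int_decode recursive_comp1[OF X(2)] recursive_int_of_nat recursive_int_const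
        recursive_intros) simp_all
  then obtain q where "\<And>\<phi> xs. length xs = 3 \<Longrightarrow> eval \<phi> q xs (Y (xs ! 0) (xs ! 1) (xs ! 2))"
    unfolding recursive_def by blast
  from this[of "[_, _, _]"] have q: "eval \<phi> q [t, i, N] (Y t i N)" for \<phi> t i N by simp
  have "\<exists>\<psi>. encodes_real \<psi> (f (y i N)) \<and> (\<forall>\<phi> n. eval \<phi> (subst_query q 2 1 pf) [n, i, N] (\<psi> n))"
    if U: "y i N \<in> U" for i N
  proof -
    have "encodes_real (\<lambda>t. Y t i N) (y i N)"
      unfolding Y_def y_def by (rule encodes_real_affine[OF X(1)])
    then obtain \<psi> where \<psi>: "encodes_real \<psi> (f (y i N))" "\<And>n. eval (\<lambda>t. Y t i N) pf [n] (\<psi> n)"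
      using pf[OF U] by blast
    have "eval \<phi> (subst_query q 2 1 pf) [n, i, N] (\<psi> n)" for \<phi> n
      using eval_subst_query[OF \<psi>(2) q, of \<phi> n] by (simp add: numeral_2_eq_2)
    with \<psi>(1) show ?thesis by blast
  qed
  then obtain \<Psi> where "\<And>i N. y i N \<in> U \<Longrightarrow> encodes_real (\<Psi> i N) (f (y i N)) \<and>
      (\<forall>\<phi> n. eval \<phi> (subst_query q 2 1 pf) [n, i, N] (\<Psi> i N n))"
    by metis
  with that show ?thesis by blast
qed

text \<open>The bound \<open>L\<close> makes the search succeed at a grid point not beyond
  \<open>P \<epsilon>\<close>, and \<open>c\<close> turns closeness of values of \<open>g\<close>
  into closeness of arguments. The program uses \<open>c\<close> and \<open>L\<close> only through
  the natural numbers \<open>B\<close> and \<open>e\<close>.\<close>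

lemma computable_inverse_increment:
  fixes s \<sigma> :: int and f g P :: "real \<Rightarrow> real" and x r c L :: real
  assumes "computable_real_fun_on U f" "computable_real x" "\<bar>\<sigma>\<bar> = 1" "c > 0" "L \<ge> 0"
    and g: "\<And>h :: real. g h = \<sigma> * (f (x + s * h) - f x)"
    and U: "\<And>h :: real. 0 \<le> h \<Longrightarrow> h < r \<Longrightarrow> x + s * h \<in> U"
    and bounds: "\<And>a b. 0 \<le> a \<Longrightarrow> a \<le> b \<Longrightarrow> b < r \<Longrightarrow>
      c * (b - a) \<le> g b - g a \<and> g b - g a \<le> L * (b - a)"
    and P: "\<And>\<epsilon>. \<epsilon> \<in> S \<Longrightarrow> 0 \<le> P \<epsilon> \<and> P \<epsilon> < r \<and> g (P \<epsilon>) = \<epsilon>"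
  shows "computable_real_fun_on S P"
proof -
  define y where "y = (\<lambda>(i::nat) (N::nat). x + s * (i / 2 ^ N))"
  obtain p \<Psi> where
    \<Psi>: "\<And>i N. y i N \<in> U \<Longrightarrow> encodes_real (\<Psi> i N) (f (y i N))" and
    p: "\<And>i N \<phi> n. y i N \<in> U \<Longrightarrow> eval \<phi> p [n, i, N] (\<Psi> i N n)"
    using computable_on_dyadic_translates[OF assms(1,2)] unfolding y_def by metis
  \<comment> \<open>The tolerance of the test, in units of \<open>2^-N\<close>: \<open>L\<close> for
    rounding \<open>P \<epsilon>\<close> down to the grid, and 3 for the three approximations
    involved.\<close>
  obtain B :: nat where B: "L + 3 \<le> B" using real_arch_simple by blast
  \<comment> \<open>Passing the test bounds the error of \<open>g\<close> by \<open>B + 3\<close>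
    units, hence that of the argument by \<open>(B + 3) / c\<close>, which \<open>2 ^ e\<close>
    dominates.\<close>
  obtain e :: nat where "(B + 3) / c < 2 ^ e" using real_arch_pow[of 2 "(B + 3) / c"] by auto
  then have e: "B + 3 \<le> c * 2 ^ e" using assms(4) by (simp add: field_simps)
  \<comment> \<open>By truncated subtraction the value is 0 exactly when the discrepancy is at most
    \<open>B\<close>.\<close>
  define T where "T = (\<lambda>a b d. nat \<bar>\<sigma> * (int_decode a - int_decode b) - int_decode d\<bar> - B)"
  \<comment> \<open>Adding \<open>2 ^ e\<close>, half of the divisor, makes the division round to a
    nearest integer.\<close>
  define out where "out = (\<lambda>i::nat. int_encode (int ((i + 2 ^ e) div 2 ^ (e + 1))))"
  have "recursive 3 (\<lambda>xs. T (xs ! 0) (xs ! 1) (xs ! 2))"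
    unfolding T_def by (intro recursive_diff recursive_nat_abs recursive_int_diff recursive_int_mult
        recursive_int_decode recursive_int_const recursive_intros) simp_all
  then obtain pT where "\<And>\<phi> xs. length xs = 3 \<Longrightarrow> eval \<phi> pT xs (T (xs ! 0) (xs ! 1) (xs ! 2))"
    unfolding recursive_def by blast
  from this[of "[_, _, _]"] have pT: "eval \<phi> pT [a, b, d] (T a b d)" for \<phi> a b d by simp
  have "recursive 1 (\<lambda>xs. out (xs ! 0))"
    unfolding out_def
    by (intro recursive_int_encode recursive_int_of_nat recursive_div recursive_intros) simp_all
  then obtain po where "\<And>\<phi> xs. length xs = 1 \<Longrightarrow> eval \<phi> po xs (out (xs ! 0))"
    unfolding recursive_def by blast
  from this[of "[_]"] have po: "eval \<phi> po [i] (out i)" for \<phi> i by simp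
  have "recursive 2 (\<lambda>xs. xs ! 1 + (e + 1))" by (intro recursive_intros) simp
  then obtain pN where "\<And>\<phi> xs. length xs = 2 \<Longrightarrow> eval \<phi> pN xs (xs ! 1 + (e + 1))"
    unfolding recursive_def by blast
  from this[of "[_, _]"] have pN: "eval \<phi> pN [i, n] (n + (e + 1))" for \<phi> i n by simp
  \<comment> \<open>The arguments are \<open>[i, n]\<close>. \<open>pN\<close> supplies the working
    precision \<open>N\<close>, \<open>Zero\<close> the grid index of \<open>x\<close> itself, and
    \<open>Query\<close> the approximation of \<open>\<epsilon>\<close>.\<close>
  define test where
    "test = Comp pT [Comp p [pN, Proj 0, pN], Comp p [pN, Zero, pN], Comp Query [pN]]"
  have "\<exists>z. eval \<phi> (Comp po [Mu test]) [n] z \<and> \<bar>real_of_int (int_decode z) - 2 ^ n * P \<epsilon>\<bar> \<le> 1"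
    if \<epsilon>: "\<epsilon> \<in> S" and \<phi>: "encodes_real \<phi> \<epsilon>" for \<epsilon> \<phi> n
  proof -
    \<comment> \<open>The \<open>e + 1\<close> additional bits absorb the error \<open>2 ^ e\<close>
      of the search and another \<open>2 ^ e\<close> from the final rounding.\<close>
    define N where "N = n + (e + 1)"
    define t where "t = (\<lambda>i. T (\<Psi> i N N) (\<Psi> 0 N N) (\<phi> N))"
    note P' = P[OF \<epsilon>]
    have U': "y i N \<in> U" if "i / 2 ^ N < r" for i
      unfolding y_def using that by (intro U) simp_all
    have U0: "y 0 N \<in> U" using P' by (intro U') simp
    have eval: "eval \<phi> test [i, n] (t i)" if i: "i / 2 ^ N < r" for i
    proof -
      have "eval \<phi> (Proj 0) [i, n] i" using eval_Proj[of 0 "[i, n]" \<phi>] by simp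
      then show ?thesis
        unfolding test_def t_def
        using pN[of \<phi> i n, folded N_def] p[OF U'[OF i], of \<phi> N] p[OF U0, of \<phi> N]
          eval_Zero[of \<phi> "[i, n]"] eval_Query[of \<phi> N "[]"]
        by (intro eval_Comp3[OF _ _ _ pT] eval_Comp3[where h = p] eval_Comp1[where h = Query])
    qed
    have approx: "\<bar>real_of_int (\<sigma> * (int_decode (\<Psi> i N N) - int_decode (\<Psi> 0 N N)) - int_decode (\<phi> N))
        - 2 ^ N * (g (i / 2 ^ N) - g (P \<epsilon>))\<bar> \<le> 3" if i: "i / 2 ^ N < r" for i
    proof -
      have 1: "\<bar>real_of_int (int_decode (\<Psi> i N N)) - 2 ^ N * f (x + s * (i / 2 ^ N))\<bar> \<le> 1"
        using \<Psi>[OF U'[OF i]] unfolding encodes_real_iff y_def by blast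
      have 2: "\<bar>real_of_int (int_decode (\<Psi> 0 N N)) - 2 ^ N * f x\<bar> \<le> 1"
        using \<Psi>[OF U0] unfolding encodes_real_iff y_def by simp
      have 3: "\<bar>real_of_int (int_decode (\<phi> N)) - 2 ^ N * \<epsilon>\<bar> \<le> 1"
        using \<phi> unfolding encodes_real_iff by blast
      consider "\<sigma> = 1" | "\<sigma> = - 1" using assms(3) by linarith
      then show ?thesis
      proof cases
        case 1
        have "2 ^ N * (g (i / 2 ^ N) - g (P \<epsilon>)) =
            2 ^ N * f (x + s * (i / 2 ^ N)) - 2 ^ N * f x - 2 ^ N * \<epsilon>"
          unfolding g[of "i / 2 ^ N"] using P' by (simp add: 1 algebra_simps)
        then show ?thesis using \<open>\<bar>_ - 2 ^ N * f (x + _)\<bar> \<le> 1\<close> 2 3 1 by simp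
      next
        case 2
        have "2 ^ N * (g (i / 2 ^ N) - g (P \<epsilon>)) =
            2 ^ N * f x - 2 ^ N * f (x + s * (i / 2 ^ N)) - 2 ^ N * \<epsilon>"
          unfolding g[of "i / 2 ^ N"] using P' by (simp add: 2 algebra_simps)
        then show ?thesis using \<open>\<bar>_ - 2 ^ N * f x\<bar> \<le> 1\<close> 1 3 2 by simp
      qed
    qed
    \<comment> \<open>The last grid index not beyond \<open>P \<epsilon>\<close>: up to it every
      test is defined, and there the test succeeds at the latest.\<close>
    define i0 where "i0 = nat \<lfloor>2 ^ N * P \<epsilon>\<rfloor>"
    have "real i0 = \<lfloor>2 ^ N * P \<epsilon>\<rfloor>" using P' by (simp add: i0_def)
    then have i0: "real i0 \<le> 2 ^ N * P \<epsilon>" "2 ^ N * P \<epsilon> \<le> i0 + 1"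
      using floor_correct[of "2 ^ N * P \<epsilon>"] by linarith+
    then have "i0 / 2 ^ N \<le> P \<epsilon>" by (simp add: field_simps)
    then have range: "i / 2 ^ N < r" if "i \<le> i0" for i
    proof -
      have "i / 2 ^ N \<le> i0 / (2 ^ N :: real)" using that by (intro divide_right_mono) auto
      with \<open>i0 / 2 ^ N \<le> P \<epsilon>\<close> P' show ?thesis by linarith
    qed
    have "t i0 = 0"
    proof -
      have "2 ^ N * (P \<epsilon> - i0 / 2 ^ N) \<le> 1" using i0 by (simp add: right_diff_distrib)
      then have "L * (2 ^ N * (P \<epsilon> - i0 / 2 ^ N)) \<le> L * 1"
        using assms(5) by (rule mult_left_mono)
      moreover have "0 \<le> c * (P \<epsilon> - i0 / 2 ^ N)" using \<open>i0 / 2 ^ N \<le> P \<epsilon>\<close> assms(4) by simp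
      then have "0 \<le> g (P \<epsilon>) - g (i0 / 2 ^ N)" "g (P \<epsilon>) - g (i0 / 2 ^ N) \<le> L * (P \<epsilon> - i0 / 2 ^ N)"
        using bounds[of "i0 / 2 ^ N" "P \<epsilon>"] \<open>i0 / 2 ^ N \<le> P \<epsilon>\<close> P' by auto
      then have "0 \<le> 2 ^ N * (g (P \<epsilon>) - g (i0 / 2 ^ N))"
        "2 ^ N * (g (P \<epsilon>) - g (i0 / 2 ^ N)) \<le> 2 ^ N * (L * (P \<epsilon> - i0 / 2 ^ N))"
        by simp_all
      ultimately have "\<bar>2 ^ N * (g (i0 / 2 ^ N) - g (P \<epsilon>))\<bar> \<le> L"
        by (simp add: algebra_simps)
      then show ?thesis
        using approx[OF range[OF order_refl]] B unfolding t_def T_def by linarith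
    qed
    define m where "m = (LEAST i. t i = 0)"
    have "m \<le> i0" unfolding m_def using \<open>t i0 = 0\<close> by (rule Least_le)
    note m_r = range[OF this]
    have "t m = 0" unfolding m_def using \<open>t i0 = 0\<close> by (rule LeastI)
    then have le: "\<bar>2 ^ N * (g (m / 2 ^ N) - g (P \<epsilon>))\<bar> \<le> B + 3"
      using approx[OF m_r] unfolding t_def T_def by linarith
    have "c * \<bar>m / 2 ^ N - P \<epsilon>\<bar> \<le> \<bar>g (m / 2 ^ N) - g (P \<epsilon>)\<bar>"
    proof (cases "m / 2 ^ N \<le> P \<epsilon>")
      case True
      then show ?thesis using bounds[of "m / 2 ^ N" "P \<epsilon>"] P' by (simp add: abs_if)
    next
      case False
      then show ?thesis using bounds[of "P \<epsilon>" "m / 2 ^ N"] P' m_r by (simp add: abs_if)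
    qed
    then have "2 ^ N * (c * \<bar>m / 2 ^ N - P \<epsilon>\<bar>) \<le> 2 ^ N * \<bar>g (m / 2 ^ N) - g (P \<epsilon>)\<bar>"
      by (rule mult_left_mono) simp
    moreover have "2 ^ N * \<bar>g (m / 2 ^ N) - g (P \<epsilon>)\<bar> \<le> B + 3" using le by (simp add: abs_mult)
    ultimately have "2 ^ N * (c * \<bar>m / 2 ^ N - P \<epsilon>\<bar>) \<le> c * 2 ^ e" using e by linarith
    then have "c * (2 ^ N * \<bar>m / 2 ^ N - P \<epsilon>\<bar>) \<le> c * 2 ^ e"
      by (simp only: mult.left_commute)
    then have "2 ^ N * \<bar>m / 2 ^ N - P \<epsilon>\<bar> \<le> 2 ^ e" using assms(4) by simp
    moreover have "2 ^ N * \<bar>m / 2 ^ N - P \<epsilon>\<bar> = \<bar>real m - 2 ^ N * P \<epsilon>\<bar>"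
      using abs_mult[of "2 ^ N" "m / 2 ^ N - P \<epsilon>"] by (simp add: right_diff_distrib)
    ultimately have m: "\<bar>real m - 2 ^ N * P \<epsilon>\<bar> \<le> 2 ^ e" by simp
    define j where "j = (m + 2 ^ e) div 2 ^ (e + 1)"
    have "m + 2 ^ e = j * 2 ^ (e + 1) + (m + 2 ^ e) mod 2 ^ (e + 1)"
      "(m + 2 ^ e) mod 2 ^ (e + 1) < 2 ^ (e + 1)"
      unfolding j_def by (rule div_mult_mod_eq[symmetric]) simp
    then have "j * 2 ^ (e + 1) \<le> m + 2 ^ e" "m + 2 ^ e < j * 2 ^ (e + 1) + 2 ^ (e + 1)"
      by linarith+
    then have "real (j * 2 ^ (e + 1)) \<le> real (m + 2 ^ e)"
      "real (m + 2 ^ e) < real (j * 2 ^ (e + 1) + 2 ^ (e + 1))"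
      by (simp_all only: of_nat_le_iff of_nat_less_iff)
    \<comment> \<open>Search and rounding contribute \<open>2 ^ e\<close> each.\<close>
    with m have "\<bar>real j * 2 ^ (e + 1) - 2 ^ N * P \<epsilon>\<bar> \<le> 2 ^ (e + 1)"
      by simp
    moreover have "real j * 2 ^ (e + 1) - 2 ^ N * P \<epsilon> = 2 ^ (e + 1) * (real j - 2 ^ n * P \<epsilon>)"
      by (simp add: N_def power_add algebra_simps)
    ultimately have "\<bar>real j - 2 ^ n * P \<epsilon>\<bar> \<le> 1" by (simp add: abs_mult)
    then have "\<bar>real_of_int (int_decode (out m)) - 2 ^ n * P \<epsilon>\<bar> \<le> 1"
      by (simp add: out_def j_def)
    moreover have "eval \<phi> (Mu test) [n] m"
      unfolding m_def using eval range \<open>t i0 = 0\<close> by (intro eval_Mu_Least) auto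
    then have "eval \<phi> (Comp po [Mu test]) [n] (out m)" by (rule eval_Comp1) (rule po)
    ultimately show ?thesis by blast
  qed
  then show ?thesis
    unfolding computable_real_fun_on_def encodes_real_iff[of _ "P _"] by metis
qed

subsection \<open>The optimal modulus of continuity\<close>

theorem theorem28:
  fixes U :: "real set" and f :: "real \<Rightarrow> real" and x :: real and k :: nat
  assumes "open U"
    and "k \<ge> 2"
    and "Ck_on k U f"
    and "x \<in> U"
    and "transversal_type U f x"
    and "deriv f x * deriv (deriv f) x \<noteq> 0"
  shows "\<exists>\<epsilon>0 > 0. \<exists>P :: real \<Rightarrow> real.
           P ` {0<..<\<epsilon>0} \<subseteq> {0<..} \<and>
           Ck_diffeo_onto_image (k - 1) {0<..<\<epsilon>0} P \<and>
           strict_mono_on {0<..<\<epsilon>0} P \<and>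
           (\<forall>\<epsilon>\<in>{0<..<\<epsilon>0}. \<forall>y\<in>U. \<bar>x - y\<bar> < P \<epsilon> \<longrightarrow> \<bar>f x - f y\<bar> < \<epsilon>) \<and>
           (\<forall>\<epsilon>\<in>{0<..<\<epsilon>0}. \<forall>\<delta>>0.
              (\<forall>y\<in>U. \<bar>x - y\<bar> < \<delta> \<longrightarrow> \<bar>f x - f y\<bar> < \<epsilon>) \<longrightarrow> \<delta> \<le> P \<epsilon>) \<and>
           (computable_real_fun_on U f \<and> computable_real x \<longrightarrow>
              computable_real_fun_on {0<..<\<epsilon>0} P)"
proof -
  have C2: "Ck_on (Suc 1) U f" using Ck_on_mono[OF assms(3), of 2] assms(2) by (simp add: numeral_2_eq_2)
  note D1 = Ck_on_SucD(1)[OF assms(1) C2]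
  have C1: "Ck_on (Suc 0) U (deriv f)" using Ck_on_SucD(2)[OF assms(1) C2] by simp
  note D2 = Ck_on_SucD(1)[OF assms(1) C1]
  have cont: "continuous_on U (deriv f)" "continuous_on U (deriv (deriv f))"
    using Ck_on_SucD(2,3)[OF assms(1) C1] by (simp_all add: Ck_on_0)
  \<comment> \<open>The signs of \<open>f'(x)\<close> and \<open>f''(x)\<close>; both derivatives
    are nonzero, so the \<open>else\<close> branches mean negative.\<close>
  define \<sigma> \<tau> where "\<sigma> = (if deriv f x > 0 then 1 else - 1 :: int)"
    and "\<tau> = (if deriv (deriv f) x > 0 then 1 else - 1 :: int)"
  define s where "s = \<sigma> * \<tau>"
  have signs: "s * s = 1" "\<tau> * s = \<sigma>" "\<sigma> * s = \<tau>" "\<bar>s\<bar> = 1" "\<bar>\<tau>\<bar> = 1" "\<bar>\<sigma>\<bar> = 1"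
    by (simp_all add: s_def \<sigma>_def \<tau>_def)
  then have rsigns: "real_of_int s * real_of_int s = 1" "\<tau> * real_of_int s = \<sigma>" "\<sigma> * real_of_int s = \<tau>"
    "\<bar>real_of_int s\<bar> = 1" "\<bar>real_of_int \<tau>\<bar> = 1"
    by (metis of_int_mult of_int_1 of_int_abs)+
  \<comment> \<open>By continuity of \<open>f'\<close> and \<open>f''\<close> their signs persist
    near \<open>x\<close>.\<close>
  obtain r where r: "r > 0" "\<And>y. \<bar>y - x\<bar> < r \<Longrightarrow>
      y \<in> U \<and> \<sigma> * deriv f y > 0 \<and> \<tau> * deriv (deriv f) y > 0"
  proof -
    have pos: "\<sigma> * deriv f x > 0" "\<tau> * deriv (deriv f) x > 0"
      using assms(6) by (auto simp: \<sigma>_def \<tau>_def)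
    have "((\<lambda>y. \<sigma> * deriv f y) \<longlongrightarrow> \<sigma> * deriv f x) (nhds x)"
      "((\<lambda>y. \<tau> * deriv (deriv f) y) \<longlongrightarrow> \<tau> * deriv (deriv f) x) (nhds x)"
      using cont assms(1,4)
      by (auto intro!: tendsto_intros
          simp: continuous_on_eq_continuous_at isCont_def tendsto_at_iff_tendsto_nhds)
    then have "\<forall>\<^sub>F y in nhds x. y \<in> U \<and> \<sigma> * deriv f y > 0 \<and> \<tau> * deriv (deriv f) y > 0"
      using pos by (intro eventually_conj eventually_nhds_in_open assms(1,4)) (auto dest: order_tendstoD(1))
    then show ?thesis
      using that unfolding eventually_nhds_metric by (auto simp: dist_real_def)
  qed
  \<comment> \<open>The factor is \<open>\<tau>\<close> because
    \<open>\<tau> * s = \<sigma>\<close>: then \<open>g' = w\<close> is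
    \<open>\<bar>f'\<bar>\<close> along the line for \<open>\<bar>h\<bar> < r\<close>. Likewise
    \<open>\<sigma> * s = \<tau>\<close> makes \<open>w'\<close> equal to
    \<open>\<bar>f''\<bar>\<close> there.\<close>
  define g where "g = (\<lambda>h::real. \<tau> * (f (x + s * h) - f x))"
  define w where "w = (\<lambda>h::real. \<sigma> * deriv f (x + s * h))"
  have near: "x + s * h \<in> U" "w h > 0" "\<tau> * deriv (deriv f) (x + s * h) > 0" if "\<bar>h\<bar> < r" for h :: real
    using r(2)[of "x + s * h"] that rsigns(4) unfolding w_def by (simp_all add: abs_mult)
  have lin: "((\<lambda>h. x + s * h) has_real_derivative s) (at h)" for h :: real
    by (auto intro!: derivative_eq_intros)
  have dg: "(g has_real_derivative w h) (at h)" if "\<bar>h\<bar> < r" for h :: real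
    unfolding g_def w_def rsigns(2)[symmetric]
    using DERIV_cmult[OF DERIV_diff[OF DERIV_chain2[OF D1[OF near(1)[OF that]] lin] DERIV_const]]
    by (rule DERIV_cong) simp
  have dw: "(w has_real_derivative \<tau> * deriv (deriv f) (x + s * h)) (at h)" if "\<bar>h\<bar> < r" for h :: real
    unfolding w_def rsigns(3)[symmetric]
    using DERIV_cmult[OF DERIV_chain2[OF D2[OF near(1)[OF that]] lin]]
    by (rule DERIV_cong) simp
  have w_mono: "w a \<le> w b" if "\<bar>a\<bar> < r" "\<bar>b\<bar> < r" "a \<le> b" for a b
  proof (rule DERIV_nonneg_imp_nondecreasing[OF that(3)])
    fix u assume "a \<le> u" "u \<le> b"
    then have "\<bar>u\<bar> < r" using that by linarith
    then show "\<exists>y. (w has_real_derivative y) (at u) \<and> 0 \<le> y"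
      using dw near(3) less_imp_le by blast
  qed
  have g_less: "g a < g b" if "\<bar>a\<bar> < r" "\<bar>b\<bar> < r" "a < b" for a b
  proof (rule DERIV_pos_imp_increasing[OF that(3)])
    fix u assume "a \<le> u" "u \<le> b"
    then have "\<bar>u\<bar> < r" using that by linarith
    then show "\<exists>y. (g has_real_derivative y) (at u) \<and> 0 < y"
      using dg near(2) by blast
  qed
  have g0: "g 0 = 0" by (simp add: g_def)
  \<comment> \<open>The sum \<open>g u + g (- u)\<close> vanishes at 0 and has derivative
    \<open>w u - w (- u)\<close>, which is nonnegative because \<open>w\<close> is nondecreasing. So
    moving against \<open>s\<close> changes \<open>f\<close> no more than moving along it.\<close>
  have reflect: "- g (- h) \<le> g h" if "0 \<le> h" "h < r" for h :: real
  proof -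
    have "g 0 + g (- 0) \<le> g h + g (- h)"
    proof (rule DERIV_nonneg_imp_nondecreasing[OF that(1)])
      fix u assume u: "0 \<le> u" "u \<le> h"
      then have ur: "\<bar>u\<bar> < r" "\<bar>- u\<bar> < r" using that by auto
      have "((\<lambda>u. g u + g (- u)) has_real_derivative w u - w (- u)) (at u)"
        using DERIV_add[OF dg[OF ur(1)] DERIV_mirror[THEN iffD1, OF dg[OF ur(2)]]] by simp
      moreover have "w (- u) \<le> w u" using w_mono[OF ur(2,1)] u by simp
      ultimately show "\<exists>y. ((\<lambda>u. g u + g (- u)) has_real_derivative y) (at u) \<and> 0 \<le> y"
        by (intro exI[of _ "w u - w (- u)"]) simp
    qed
    then show ?thesis using g0 by simp
  qed
  have g_abs: "\<bar>g u\<bar> < g h" if "\<bar>u\<bar> < h" "h < r" for u h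
  proof (cases "u \<ge> 0")
    case True
    then have "g 0 \<le> g u" using g_less[of 0 u] that by (cases "u = 0") auto
    moreover have "g u < g h" using g_less[of u h] that by auto
    ultimately show ?thesis using g0 by simp
  next
    case False
    then have "g u < g 0" "g (- u) < g h" "- g u \<le> g (- u)"
      using g_less[of u 0] g_less[of "- u" h] reflect[of "- u"] that by auto
    then show ?thesis using g0 by simp
  qed
  \<comment> \<open>Shrinking the radius keeps the endpoint \<open>R\<close> inside the region where
    the signs are controlled.\<close>
  define R where "R = r / 2"
  have R: "0 < R" "R < r" using r(1) by (simp_all add: R_def)
  define P where "P = inv_into {0<..<R} g"
  have Ck_g: "Ck_on (k - 1) {0<..<R} g"
  proof -
    have "Ck_on (k - 1) {0<..<R} (\<lambda>h. x + s * h)"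
      by (intro Ck_on_add Ck_on_mult Ck_on_const Ck_on_ident open_greaterThanLessThan)
    moreover have "Ck_on (k - 1) U f" using assms(3) by (rule Ck_on_mono) simp
    moreover have "(\<lambda>h. x + s * h) ` {0<..<R} \<subseteq> U" using near(1) R by auto
    ultimately have "Ck_on (k - 1) {0<..<R} (\<lambda>h. f (x + s * h))"
      using Ck_on_compose[OF open_greaterThanLessThan assms(1)] by blast
    then have "Ck_on (k - 1) {0<..<R} (\<lambda>h. \<tau> * (f (x + s * h) + - f x))"
      by (intro Ck_on_mult Ck_on_add Ck_on_const open_greaterThanLessThan)
    then show ?thesis by (simp add: g_def)
  qed
  have k1: "k - 1 \<ge> 1" using assms(2) by simp
  have inside: "\<bar>u\<bar> < r" if "0 \<le> u" "u \<le> R" for u using that R by simp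
  have inv: "P ` {0<..<g R} = {0<..<R}" "\<And>\<epsilon>. \<epsilon> \<in> {0<..<g R} \<Longrightarrow> g (P \<epsilon>) = \<epsilon>"
    "strict_mono_on {0<..<g R} P" "Ck_diffeo_onto_image (k - 1) {0<..<g R} P"
    unfolding P_def
    using Ck_diffeo_inv_into[OF R(1) k1 Ck_g g0, of w] dg[OF inside] near(2)[OF inside] by blast+
  have P_in: "0 < P \<epsilon>" "P \<epsilon> < R" "P \<epsilon> < r" if "\<epsilon> \<in> {0<..<g R}" for \<epsilon>
    using imageI[OF that, of P] R(2) unfolding inv(1) by auto
  show ?thesis
  proof (intro exI[of _ "g R"] exI[of _ P] conjI impI ballI allI)
    show "g R > 0" using g_less[of 0 R] g0 R by simp
    show "P ` {0<..<g R} \<subseteq> {0<..}" using P_in(1) by auto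
    show "Ck_diffeo_onto_image (k - 1) {0<..<g R} P" "strict_mono_on {0<..<g R} P"
      by (rule inv)+
  next
    fix \<epsilon> y assume \<epsilon>: "\<epsilon> \<in> {0<..<g R}" and y: "\<bar>x - y\<bar> < P \<epsilon>"
    \<comment> \<open>As \<open>s * s = 1\<close>, this is the coordinate of \<open>y\<close> in
      direction \<open>s\<close>, and it has the same distance from 0 as \<open>y\<close> from
      \<open>x\<close>.\<close>
    define u where "u = s * (y - x)"
    have "x + s * u = y" using rsigns(1) by (simp add: u_def mult.assoc[symmetric])
    moreover have "\<bar>u\<bar> < P \<epsilon>" using y rsigns(4) by (simp add: u_def abs_mult)
    then have "\<bar>g u\<bar> < \<epsilon>" using g_abs[of u "P \<epsilon>"] P_in(3)[OF \<epsilon>] inv(2)[OF \<epsilon>] by simp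
    ultimately show "\<bar>f x - f y\<bar> < \<epsilon>"
      using rsigns(5) by (simp add: g_def abs_mult abs_minus_commute)
  next
    fix \<epsilon> \<delta> assume \<epsilon>: "\<epsilon> \<in> {0<..<g R}"
      and \<delta>: "\<forall>y\<in>U. \<bar>x - y\<bar> < \<delta> \<longrightarrow> \<bar>f x - f y\<bar> < \<epsilon>"
    show "\<delta> \<le> P \<epsilon>"
    proof (rule ccontr)
      \<comment> \<open>The point \<open>x + s * P \<epsilon>\<close> would then be admissible, but
        the increment of \<open>f\<close> there is exactly \<open>\<epsilon>\<close> in absolute
        value.\<close>
      assume "\<not> \<delta> \<le> P \<epsilon>"
      then have "\<bar>f x - f (x + s * P \<epsilon>)\<bar> < \<epsilon>"
        using \<delta> near(1)[of "P \<epsilon>"] P_in[OF \<epsilon>] rsigns(4) by (simp add: abs_mult)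
      moreover have "\<bar>g (P \<epsilon>)\<bar> = \<bar>f x - f (x + s * P \<epsilon>)\<bar>"
        using rsigns(5) by (simp add: g_def abs_mult abs_minus_commute)
      ultimately show False using inv(2)[OF \<epsilon>] by simp
    qed
  next
    assume comp: "computable_real_fun_on U f \<and> computable_real x"
    show "computable_real_fun_on {0<..<g R} P"
    \<comment> \<open>Since \<open>w = g'\<close> is nondecreasing, its values at 0 and
      \<open>R\<close> bound all difference quotients of \<open>g\<close> in between, by the mean
      value theorem.\<close>
    proof (rule computable_inverse_increment[where g = g and s = s and \<sigma> = \<tau> and c = "w 0" and L = "w R"
          and r = R and U = U and f = f and x = x])
      show "w 0 > 0" "w R \<ge> 0" using near(2)[of 0] near(2)[of R] R by simp_all
      show "g h = \<tau> * (f (x + s * h) - f x)" for h :: real by (simp add: g_def)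
      show "x + s * h \<in> U" if "0 \<le> h" "h < R" for h :: real using that R by (intro near(1)) simp
      show "w 0 * (b - a) \<le> g b - g a \<and> g b - g a \<le> w R * (b - a)"
        if ab: "0 \<le> a" "a \<le> b" "b < R" for a b
      proof (cases "a = b")
        case False
        then have "a < b" using ab by simp
        then obtain z where z: "a < z" "z < b" "g b - g a = (b - a) * w z"
          using MVT2[of a b g w] dg ab R by force
        then have "w 0 \<le> w z" "w z \<le> w R" using ab R by (auto intro!: w_mono)
        then show ?thesis using z \<open>a < b\<close> by (simp add: mult.commute)
      qed simp
      show "0 \<le> P \<epsilon> \<and> P \<epsilon> < R \<and> g (P \<epsilon>) = \<epsilon>" if "\<epsilon> \<in> {0<..<g R}" for \<epsilon>
        using P_in[OF that] inv(2)[OF that] by simp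
    qed (use comp signs in simp_all)
  qed
qed

end
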